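(* There are compact sets $A\subset\mathbb{R}^2$ with property $(K^s)$ having Hausdorff dimension $2$.
   Context: Identify the plane $\mathbb{R}^2$ with $\mathbb{C}$. A rigid motion is an orientation-preserving isometry of the plane (a translation or a rotation), i.e. a map $x\mapsto ux+c$ with $u,c\in\mathbb{C}$, $|u|=1$. The identity map is denoted by $j$. A continuous movement $M$ is a map $t\mapsto M_t$ ($t\in[0,1]$) such that $M_t$ is a rigid motion for every $t\in[0,1]$, the map $(t,x)\mapsto M_t(x)$ is continuous on $[0,1]\times\mathbb{R}^2$, and $M_0=j$. For a set $A\subset\mathbb{R}^2$ put $W_M(A)=\{M_t(x)\colon t\in[0,1],\ x\in A\}$. Let $\lambda$ denote two-dimensional Lebesgue measure. The set $A$ has property $(K^s)$ (the strong Kakeya property) if for every rigid motion $\alpha$ and for every $\varepsilon>0$ there exists a continuous movement $M$ with $M_1=\alpha$ and $\lambda(W_M(A))<\varepsilon$. *)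

theory Defs
  imports "HOL-Analysis.Analysis"
begin

(* Isabelle has 0 powr 0 = 0, whereas in the definition of Hausdorff measure
   diam(U)^0 = 1 for every nonempty U, and diam({})^s = 0 for all s. *)
definition diam_powr :: "real \<Rightarrow> 'a::metric_space set \<Rightarrow> ennreal" where
  "diam_powr s U =
     (if U = {} then 0 else if s = 0 then 1 else ennreal (diameter U powr s))"

(* Boundedness is explicit because the library's diameter is unspecified on unbounded sets.
   Finite covers are included, since members of the sequence may be empty. *)
definition countable_covers :: "real \<Rightarrow> 'a::metric_space set \<Rightarrow> (nat \<Rightarrow> 'a set) set" where
  "countable_covers \<delta> A =
     {U. A \<subseteq> (\<Union>i. U i) \<and> (\<forall>i. bounded (U i) \<and> diameter (U i) \<le> \<delta>)}"

definition hausdorff_premeasure :: "real \<Rightarrow> real \<Rightarrow> 'a::metric_space set \<Rightarrow> ennreal" where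
  "hausdorff_premeasure s \<delta> A = (INF U \<in> countable_covers \<delta> A. \<Sum>i. diam_powr s (U i))"

definition hausdorff_measure :: "real \<Rightarrow> 'a::metric_space set \<Rightarrow> ennreal" where
  "hausdorff_measure s A = (SUP \<delta> \<in> {0<..}. hausdorff_premeasure s \<delta> A)"

definition hausdorff_dim :: "'a::metric_space set \<Rightarrow> ennreal" where
  "hausdorff_dim A = Inf {ennreal s | s. 0 \<le> s \<and> hausdorff_measure s A = 0}"

definition rigid_motion :: "(complex \<Rightarrow> complex) \<Rightarrow> bool" where
  "rigid_motion f \<longleftrightarrow> (\<exists>u c. norm u = 1 \<and> f = (\<lambda>x. u * x + c))"

definition continuous_movement :: "(real \<Rightarrow> complex \<Rightarrow> complex) \<Rightarrow> bool" where
  "continuous_movement M \<longleftrightarrow>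
     (\<forall>t\<in>{0..1}. rigid_motion (M t)) \<and>
     continuous_on ({0..1} \<times> UNIV) (\<lambda>(t, x). M t x) \<and>
     M 0 = id"

definition swept_set :: "(real \<Rightarrow> complex \<Rightarrow> complex) \<Rightarrow> complex set \<Rightarrow> complex set" where
  "swept_set M A = {M t x | t x. t \<in> {0..1} \<and> x \<in> A}"

(* Measurability is explicit because emeasure is 0 on non-measurable sets;
   it is automatic when A is compact. *)
definition strong_Kakeya :: "complex set \<Rightarrow> bool" where
  "strong_Kakeya A \<longleftrightarrow>
     (\<forall>\<alpha> \<epsilon>. rigid_motion \<alpha> \<and> (0::real) < \<epsilon> \<longrightarrow>
        (\<exists>M. continuous_movement M \<and> M 1 = \<alpha> \<and>
             swept_set M A \<in> sets lebesgue \<and>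
             emeasure lebesgue (swept_set M A) < ennreal \<epsilon>))"

end

theory Submission
  imports Defs "HOL-Library.Discrete_Functions" "HOL-Real_Asymp.Real_Asymp"
begin

text \<open>
  Let \<open>D \<subseteq> [1,2]\<close> be compact of dimension 1 such that \<open>D\<close> and even \<open>D + D\<close> are null, and let \<open>A\<close>
  consist of the points of the first quadrant whose coordinates have their squares in \<open>D\<close>.
  The two coordinate projections of \<open>A\<close> are null, so translations parallel to the axes sweep out
  null sets. Since \<open>\<bar>z\<bar>\<^sup>2 \<in> D + D\<close> on \<open>A\<close>, so do the rotations about the origin. Every rigid motion
  is a rotation about the origin followed by a translation in each of the two rotated axis
  directions, so \<open>A\<close> can even be moved within a null set.

  The binary expansions of the numbers in \<open>D\<close> have zeros in longer and longer blocks, which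
  makes \<open>D\<close> and \<open>D + D\<close> null. The blocks are so sparse that inserting them into binary expansions
  has an inverse that is Hoelder continuous with every exponent below 1. Thus \<open>A\<close> has dimension 2.
\<close>

section \<open>Positions of the digits after the insertion of zeros\<close>

text \<open>The position of the binary digit number \<open>n \<ge> 1\<close> after the insertion of the zeros: there are
  \<open>2k - 1\<close> of them in front of digit number \<open>2^k\<close> for \<open>k \<ge> 1\<close>, and hence only \<open>o(n)\<close> among the first \<open>n\<close> digits.\<close>

definition digit_pos :: "nat \<Rightarrow> nat" where
  "digit_pos n = n + (floor_log n)\<^sup>2"

lemma digit_pos_0 [simp]: "digit_pos 0 = 0"
  by (simp add: digit_pos_def)

lemma digit_pos_less_Suc: "digit_pos n < digit_pos (Suc n)"
proof -
  have "floor_log n \<le> floor_log (Suc n)"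
    by (rule floor_log_le_iff) simp
  then have "(floor_log n)\<^sup>2 \<le> (floor_log (Suc n))\<^sup>2"
    by (rule power_mono) simp
  then show ?thesis
    unfolding digit_pos_def by linarith
qed

lemma digit_pos_add_le: "digit_pos n + k \<le> digit_pos (n + k)"
proof (induction k)
  case (Suc k)
  then show ?case
    using digit_pos_less_Suc[of "n + k"] by simp
qed simp

text \<open>At a power of two \<open>floor_log\<close> jumps by one, and its square by about twice
  the exponent. These long gaps are what makes \<open>lacunary\<close> sets null.\<close>

lemma digit_pos_gap_unbounded: "\<exists>n. k \<le> digit_pos (Suc n) - digit_pos n"
proof -
  define n :: nat where "n = 2 ^ Suc k - 1"
  have "Suc n = 2 ^ Suc k"
    by (simp add: n_def)
  then have S: "floor_log (Suc n) = Suc k"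
    by (metis floor_log_power)
  have "floor_log n \<le> k"
  proof (rule ccontr)
    assume "\<not> floor_log n \<le> k"
    then have "(2::nat) ^ Suc k \<le> 2 ^ floor_log n"
      by (intro power_increasing) auto
    also have "\<dots> \<le> n"
      by (rule floor_log_exp2_le) (use \<open>Suc n = 2 ^ Suc k\<close> in \<open>auto intro: ccontr\<close>)
    finally show False
      using \<open>Suc n = 2 ^ Suc k\<close> by simp
  qed
  then have "(floor_log n)\<^sup>2 \<le> k\<^sup>2"
    by (rule power_mono) simp
  then have "k \<le> digit_pos (Suc n) - digit_pos n"
    unfolding digit_pos_def S by (simp add: power2_eq_square)
  then show ?thesis ..
qed

text \<open>A squared logarithm is \<open>o(n)\<close>, so any factor \<open>s < 2\<close> is
  admissible, at the price of an additive constant for the finitely many small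
  \<open>n\<close>.\<close>

lemma digit_pos_growth:
  assumes "0 \<le> s" "s < (2::real)"
  shows "\<exists>C. \<forall>n. s * real (digit_pos n) \<le> 2 * real n + C"
proof -
  have "eventually (\<lambda>n. s * (real n + (log 2 (real n))\<^sup>2) \<le> 2 * real n) at_top"
    using assms by real_asymp
  then obtain N where N: "\<And>n. n \<ge> N \<Longrightarrow> s * (real n + (log 2 (real n))\<^sup>2) \<le> 2 * real n"
    by (auto simp: eventually_at_top_linorder)
  define C where "C = s * real (digit_pos N)"
  have "s * real (digit_pos n) \<le> 2 * real n + C" for n
  proof (cases "n \<ge> N \<and> n > 0")
    case True
    then have "real (floor_log n) \<le> log 2 (real n)"
      by (simp add: floor_log_altdef)
    then have "(real (floor_log n))\<^sup>2 \<le> (log 2 (real n))\<^sup>2"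
      by (rule power_mono) simp
    then have "s * real (digit_pos n) \<le> s * (real n + (log 2 (real n))\<^sup>2)"
      using assms by (intro mult_left_mono) (simp_all add: digit_pos_def)
    also have "\<dots> \<le> 2 * real n"
      using N True by blast
    finally show ?thesis
      using assms by (simp add: C_def add_increasing2)
  next
    case False
    then have "digit_pos n \<le> digit_pos N"
      using digit_pos_add_le[of n "N - n"] by (cases "n = 0") auto
    then have "s * real (digit_pos n) \<le> C"
      unfolding C_def using assms by (intro mult_left_mono) auto
    then show ?thesis
      by simp
  qed
  then show ?thesis by blast
qed

section \<open>Insertion of zeros into integers and into binary expansions\<close>

text \<open>For \<open>0 \<le> k < 2 ^ n\<close>, the \<open>n\<close> binary digits of
  \<open>k\<close> are moved apart to a word of \<open>digit_pos n\<close> digits.\<close>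

fun spread :: "nat \<Rightarrow> int \<Rightarrow> int" where
  "spread 0 k = 0"
| "spread (Suc n) k = 2 ^ (digit_pos (Suc n) - digit_pos n) * spread n (k div 2) + k mod 2"

text \<open>The last digits contribute equally to both sides; the difference of the remaining parts
  is doubled on the left, but multiplied by a power of two that is at least 2 on the right.\<close>

lemma spread_expands:
  "\<lbrakk>0 \<le> k; k \<le> l; l < 2 ^ n\<rbrakk> \<Longrightarrow> l - k \<le> spread n l - spread n k"
proof (induction n arbitrary: k l)
  case (Suc n)
  have IH: "l div 2 - k div 2 \<le> spread n (l div 2) - spread n (k div 2)"
    using Suc.prems by (intro Suc.IH) auto
  have d: "0 \<le> l div 2 - k div 2"
    using Suc.prems by auto
  have "(2::int) ^ 1 \<le> 2 ^ (digit_pos (Suc n) - digit_pos n)"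
    using digit_pos_less_Suc[of n] by (intro power_increasing) auto
  then have "2 * (l div 2 - k div 2)
      \<le> 2 ^ (digit_pos (Suc n) - digit_pos n) * (spread n (l div 2) - spread n (k div 2))"
    using IH d by (intro mult_mono) auto
  moreover have "l = 2 * (l div 2) + l mod 2" "k = 2 * (k div 2) + k mod 2"
    by auto
  ultimately show ?case
    unfolding spread.simps right_diff_distrib by linarith
qed auto

text \<open>Digits are counted from 0 here, while \<open>digit_pos\<close> numbers them from 1.
  Hence \<open>digit n\<close> is paired with \<open>digit_pos (Suc n)\<close> below.\<close>

definition digit :: "nat \<Rightarrow> real \<Rightarrow> real" where
  "digit n x = of_int (\<lfloor>2 ^ Suc n * x\<rfloor> mod 2)"

definition insert_zeros :: "real \<Rightarrow> real" where
  "insert_zeros x = (\<Sum>n. digit n x / 2 ^ digit_pos (Suc n))"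

lemma digit_bounds: "0 \<le> digit n x" "digit n x \<le> 1"
proof -
  have "0 \<le> \<lfloor>2 ^ Suc n * x\<rfloor> mod 2" "\<lfloor>2 ^ Suc n * x\<rfloor> mod 2 \<le> 1"
    by auto
  then show "0 \<le> digit n x" "digit n x \<le> 1"
    unfolding digit_def by linarith+
qed

lemma digit_term_le: "digit (i + n) x / 2 ^ digit_pos (Suc (i + n)) \<le> (1 / 2 ^ digit_pos (Suc n)) * (1/2) ^ i"
proof -
  have "(2::real) ^ (digit_pos (Suc n) + i) \<le> 2 ^ digit_pos (Suc (i + n))"
    using digit_pos_add_le[of "Suc n" i] by (intro power_increasing) (auto simp: ac_simps)
  then have "digit (i + n) x / 2 ^ digit_pos (Suc (i + n)) \<le> 1 / 2 ^ (digit_pos (Suc n) + i)"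
    using digit_bounds[of "i + n" x] by (intro frac_le) auto
  then show ?thesis
    by (simp add: power_add power_one_over)
qed

lemma summable_digits: "summable (\<lambda>n. digit n x / 2 ^ digit_pos (Suc n))"
proof (rule summable_comparison_test')
  show "summable (\<lambda>n. (1 / 2 ^ digit_pos (Suc 0)) * (1/2::real) ^ n)"
    by (intro summable_mult summable_geometric) simp
  show "norm (digit n x / 2 ^ digit_pos (Suc n)) \<le> (1 / 2 ^ digit_pos (Suc 0)) * (1/2::real) ^ n" for n
    using digit_term_le[of n 0 x] digit_bounds[of n x] by simp
qed

text \<open>\<open>\<lfloor>2 ^ n * x\<rfloor>\<close> is the integer formed by the first
  \<open>n\<close> binary digits of \<open>x\<close>, and \<open>div 2\<close> drops its last digit,
  as in the recursion of \<open>spread\<close>.\<close>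

lemma digit_partial_sum:
  assumes "0 \<le> x" "x < 1"
  shows "(\<Sum>i<n. digit i x / 2 ^ digit_pos (Suc i)) = of_int (spread n \<lfloor>2 ^ n * x\<rfloor>) / 2 ^ digit_pos n"
proof (induction n)
  case (Suc n)
  have "\<lfloor>2 ^ Suc n * x\<rfloor> div 2 = \<lfloor>2 ^ n * x\<rfloor>"
    using floor_divide_real_eq_div[of 2 "2 ^ Suc n * x"] by simp
  then have eq: "of_int (spread (Suc n) \<lfloor>2 ^ Suc n * x\<rfloor>)
      = 2 ^ (digit_pos (Suc n) - digit_pos n) * of_int (spread n \<lfloor>2 ^ n * x\<rfloor>) + digit n x"
    by (simp add: digit_def)
  have "(2::real) ^ digit_pos (Suc n) = 2 ^ (digit_pos (Suc n) - digit_pos n) * 2 ^ digit_pos n"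
    using digit_pos_less_Suc[of n] by (simp flip: power_add)
  then show ?case
    unfolding eq by (simp add: Suc.IH add_divide_distrib)
qed simp

text \<open>The error is the tail of the series: nonnegative, and dominated by a geometric series
  that starts at position \<open>digit_pos (Suc n)\<close>.\<close>

lemma insert_zeros_approx:
  assumes "0 \<le> x" "x < 1"
  shows "of_int (spread n \<lfloor>2 ^ n * x\<rfloor>) / 2 ^ digit_pos n \<le> insert_zeros x"
    and "insert_zeros x \<le> of_int (spread n \<lfloor>2 ^ n * x\<rfloor>) / 2 ^ digit_pos n + 2 / 2 ^ digit_pos (Suc n)"
proof -
  let ?f = "\<lambda>i. digit i x / 2 ^ digit_pos (Suc i)"
  have eq: "insert_zeros x = (\<Sum>i. ?f (i + n)) + of_int (spread n \<lfloor>2 ^ n * x\<rfloor>) / 2 ^ digit_pos n"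
    unfolding insert_zeros_def digit_partial_sum[OF assms, symmetric]
    by (rule suminf_split_initial_segment[OF summable_digits])
  have sm: "summable (\<lambda>i. ?f (i + n))"
    using summable_digits[of x] by (subst summable_iff_shift)
  have "0 \<le> (\<Sum>i. ?f (i + n))"
    using sm digit_bounds by (intro suminf_nonneg) auto
  then show "of_int (spread n \<lfloor>2 ^ n * x\<rfloor>) / 2 ^ digit_pos n \<le> insert_zeros x"
    using eq by simp
  have "(\<Sum>i. ?f (i + n)) \<le> (\<Sum>i. (1 / 2 ^ digit_pos (Suc n)) * (1/2) ^ i)"
    using digit_term_le sm by (intro suminf_le summable_mult summable_geometric) auto
  also have "\<dots> = 2 / 2 ^ digit_pos (Suc n)"
    by (subst suminf_mult) (simp_all add: suminf_geometric)
  finally show "insert_zeros x \<le> of_int (spread n \<lfloor>2 ^ n * x\<rfloor>) / 2 ^ digit_pos n + 2 / 2 ^ digit_pos (Suc n)"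
    using eq by simp
qed

lemma insert_zeros_bounds:
  assumes "0 \<le> x" "x < 1"
  shows "0 \<le> insert_zeros x" "insert_zeros x \<le> 1"
  using insert_zeros_approx[OF assms, of 0] by (simp_all add: digit_pos_def)

text \<open>At the coarsest dyadic scale that tells \<open>x\<close> and \<open>y\<close> clearly
  apart, \<open>spread_expands\<close> keeps their truncations apart, and the tails are too small to
  close the gap.\<close>

lemma insert_zeros_separates:
  assumes "0 \<le> x" "x < y" "y < 1"
  shows "\<exists>n. y - x < 6 / 2 ^ n \<and> 1 / 2 ^ digit_pos n \<le> insert_zeros y - insert_zeros x"
proof -
  have "\<exists>n. 3 / (y - x) < 2 ^ n"
    by (rule real_arch_pow) simp
  then obtain m where "3 / (y - x) < 2 ^ m" ..
  then have ex: "3 \<le> 2 ^ m * (y - x)"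
    using assms by (simp add: field_simps)
  \<comment> \<open>Of three units \<open>1 / 2 ^ n\<close>, rounding down costs less than one. Of
    the two that survive in \<open>spread\<close>, the tail of \<open>insert_zeros x\<close> costs
    at most one. Minimality of \<open>n\<close> gives the factor 6.\<close>
  define n where "n = (LEAST n. 3 \<le> 2 ^ n * (y - x))"
  have n: "3 \<le> 2 ^ n * (y - x)"
    unfolding n_def by (rule LeastI[of _ m]) (rule ex)
  have "n \<noteq> 0"
    using n assms by (intro notI) simp
  then obtain k where k: "n = Suc k"
    by (cases n) auto
  have "\<not> 3 \<le> 2 ^ k * (y - x)"
    using not_less_Least[of k "\<lambda>n. 3 \<le> 2 ^ n * (y - x)"] k n_def by simp
  then have small: "y - x < 6 / 2 ^ n"
    using k by (simp add: field_simps)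
  let ?k = "\<lfloor>2 ^ n * x\<rfloor>" and ?l = "\<lfloor>2 ^ n * y\<rfloor>"
  have "2 \<le> ?l - ?k"
    using n by (simp add: algebra_simps) linarith
  moreover have "0 \<le> ?k" "?l < 2 ^ n"
    using assms by (auto simp: floor_less_iff)
  ultimately have "2 \<le> spread n ?l - spread n ?k"
    using spread_expands[of ?k ?l n] by linarith
  then have "2 \<le> real_of_int (spread n ?l) - real_of_int (spread n ?k)"
    by linarith
  then have "2 / 2 ^ digit_pos n \<le> (real_of_int (spread n ?l) - real_of_int (spread n ?k)) / 2 ^ digit_pos n"
    by (intro divide_right_mono) auto
  moreover have "2 / 2 ^ digit_pos (Suc n) \<le> 1 / (2::real) ^ digit_pos n"
  proof -
    have "(2::real) ^ (digit_pos n + 1) \<le> 2 ^ digit_pos (Suc n)"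
      using digit_pos_less_Suc[of n] by (intro power_increasing) auto
    then show ?thesis
      by (simp add: field_simps)
  qed
  moreover have "real_of_int (spread n ?l) / 2 ^ digit_pos n \<le> insert_zeros y"
    "insert_zeros x \<le> real_of_int (spread n ?k) / 2 ^ digit_pos n + 2 / 2 ^ digit_pos (Suc n)"
    using assms by (auto intro!: insert_zeros_approx)
  ultimately have "1 / 2 ^ digit_pos n \<le> insert_zeros y - insert_zeros x"
    by (simp add: diff_divide_distrib)
  then show ?thesis
    using small by blast
qed

text \<open>Distances of order \<open>1 / 2 ^ n\<close> become at least
  \<open>1 / 2 ^ digit_pos n\<close>, and \<open>digit_pos_growth\<close> compares the exponents.
  Squares appear because they add up to squared distances in the plane.\<close>

lemma insert_zeros_Hoelder:
  assumes s: "0 \<le> s" "s < 2"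
  obtains K where "K > 0" and
    "\<And>x y. \<lbrakk>0 \<le> x; x < 1; 0 \<le> y; y < 1\<rbrakk> \<Longrightarrow>
       (x - y)\<^sup>2 \<le> K * \<bar>insert_zeros x - insert_zeros y\<bar> powr s"
proof -
  obtain C where C: "\<And>n. s * real (digit_pos n) \<le> 2 * real n + C"
    using digit_pos_growth[OF s] by blast
  \<comment> \<open>The 36 is the square of the 6 in \<open>insert_zeros_separates\<close>; the
    other factor absorbs the constant of \<open>digit_pos_growth\<close>.\<close>
  define K where "K = 36 * 2 powr C"
  have less: "(x - y)\<^sup>2 \<le> K * \<bar>insert_zeros x - insert_zeros y\<bar> powr s"
    if xy: "0 \<le> x" "x < y" "y < 1" for x y
  proof -
    obtain n where n: "y - x < 6 / 2 ^ n" "1 / 2 ^ digit_pos n \<le> insert_zeros y - insert_zeros x"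
      using insert_zeros_separates[OF xy] by blast
    have "(x - y)\<^sup>2 = (y - x)\<^sup>2"
      by (simp add: power2_commute)
    also have "\<dots> \<le> (6 / 2 ^ n)\<^sup>2"
      using n xy by (intro power_mono) auto
    also have "\<dots> = 36 * 2 powr (- 2 * real n)"
      by (simp add: power_divide powr_minus powr_realpow[symmetric] powr_powr divide_simps
          flip: powr_add power_mult)
        (simp add: powr_realpow[symmetric] mult.commute flip: powr_add)
    also have "\<dots> \<le> 36 * 2 powr (C - s * real (digit_pos n))"
      using C[of n] by (intro mult_left_mono powr_mono) auto
    also have "\<dots> = K * (1 / 2 ^ digit_pos n) powr s"
      by (simp add: K_def powr_diff powr_divide powr_powr mult.commute flip: powr_realpow)
    also have "\<dots> \<le> K * \<bar>insert_zeros x - insert_zeros y\<bar> powr s"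
      using n s unfolding K_def by (intro mult_left_mono powr_mono2) auto
    finally show ?thesis .
  qed
  show ?thesis
  proof (rule that)
    show "K > 0"
      by (simp add: K_def)
    fix x y :: real
    assume "0 \<le> x" "x < 1" "0 \<le> y" "y < 1"
    then show "(x - y)\<^sup>2 \<le> K * \<bar>insert_zeros x - insert_zeros y\<bar> powr s"
      using less[of x y] less[of y x]
      by (cases x y rule: linorder_cases) (auto simp: power2_commute abs_minus_commute)
  qed
qed

section \<open>Closed null sets of lacunary numbers\<close>

text \<open>Expresses that (almost) only zeros stand between the positions \<open>digit_pos n\<close> and
  \<open>digit_pos (Suc n)\<close>. Unlike a condition on digits, this one is closed and behaves well under
  addition.\<close>

definition lacunary :: "real \<Rightarrow> real set" where
  "lacunary c = {x. \<forall>n. infdist (2 ^ digit_pos n * x) \<int> \<le> c / 2 ^ (digit_pos (Suc n) - digit_pos n)}"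

lemma lacunaryD:
  "x \<in> lacunary c \<Longrightarrow> infdist (2 ^ digit_pos n * x) \<int> \<le> c / 2 ^ (digit_pos (Suc n) - digit_pos n)"
  by (simp add: lacunary_def)

lemma closed_lacunary: "closed (lacunary c)"
  unfolding lacunary_def
  by (intro closed_Collect_all closed_Collect_le continuous_intros)

text \<open>Multiplication by \<open>2 ^ digit_pos n\<close> turns the first \<open>n\<close> digits
  into an integer and leaves a tail that begins only after the gap. Adding 1 keeps away from 0,
  where the square root is not differentiable.\<close>

lemma insert_zeros_lacunary:
  assumes "0 \<le> x" "x < 1"
  shows "1 + insert_zeros x \<in> lacunary 2"
  unfolding lacunary_def
proof (rule CollectI, rule allI)
  fix n
  let ?m = "real_of_int (spread n \<lfloor>2 ^ n * x\<rfloor>)"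
  have "(2::real) ^ digit_pos (Suc n) = 2 ^ (digit_pos (Suc n) - digit_pos n) * 2 ^ digit_pos n"
    using digit_pos_less_Suc[of n] by (simp flip: power_add)
  then have "?m \<le> 2 ^ digit_pos n * insert_zeros x"
    "2 ^ digit_pos n * insert_zeros x \<le> ?m + 2 / 2 ^ (digit_pos (Suc n) - digit_pos n)"
    using insert_zeros_approx[OF assms, of n] by (simp_all add: field_simps)
  then have "dist (2 ^ digit_pos n * (1 + insert_zeros x)) (2 ^ digit_pos n + ?m) \<le> 2 / 2 ^ (digit_pos (Suc n) - digit_pos n)"
    by (simp add: dist_real_def algebra_simps)
  moreover have "2 ^ digit_pos n + ?m \<in> \<int>"
    by simp
  ultimately show "infdist (2 ^ digit_pos n * (1 + insert_zeros x)) \<int> \<le> 2 / 2 ^ (digit_pos (Suc n) - digit_pos n)"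
    using infdist_le order_trans by blast
qed

text \<open>Nearest integers add up, and so do the errors. This serves the rotations, since a
  squared modulus is a sum of two squared coordinates.\<close>

lemma lacunary_add:
  assumes "x \<in> lacunary c" "y \<in> lacunary d"
  shows "x + y \<in> lacunary (c + d)"
  unfolding lacunary_def
proof (rule CollectI, rule allI)
  fix n
  have ne: "(\<int>::real set) \<noteq> {}"
    using Ints_0 by blast
  obtain i where i: "i \<in> \<int>" "infdist (2 ^ digit_pos n * x) \<int> = dist (2 ^ digit_pos n * x) i"
    using infdist_attains_inf[OF closed_Ints ne] .
  obtain j where j: "j \<in> \<int>" "infdist (2 ^ digit_pos n * y) \<int> = dist (2 ^ digit_pos n * y) j"
    using infdist_attains_inf[OF closed_Ints ne] .
  have "infdist (2 ^ digit_pos n * (x + y)) \<int> \<le> dist (2 ^ digit_pos n * (x + y)) (i + j)"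
    using i j by (intro infdist_le Ints_add)
  also have "\<dots> \<le> dist (2 ^ digit_pos n * x) i + dist (2 ^ digit_pos n * y) j"
    by (simp add: distrib_left dist_triangle_add)
  also have "\<dots> \<le> c / 2 ^ (digit_pos (Suc n) - digit_pos n) + d / 2 ^ (digit_pos (Suc n) - digit_pos n)"
    using lacunaryD[OF assms(1), of n] lacunaryD[OF assms(2), of n] i(2) j(2) by simp
  finally show "infdist (2 ^ digit_pos n * (x + y)) \<int> \<le> (c + d) / 2 ^ (digit_pos (Suc n) - digit_pos n)"
    by (simp add: add_divide_distrib)
qed

text \<open>For each \<open>\<epsilon>\<close> a single \<open>n\<close> with a long gap suffices:
  with \<open>N = 2 ^ digit_pos n\<close>, the set lies within \<open>\<delta> / N\<close> of the
  multiples of \<open>1 / N\<close>, of which only about \<open>4 * N\<close> matter.\<close>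

lemma negligible_lacunary:
  assumes c: "0 \<le> c"
  shows "negligible (lacunary c \<inter> {0..4})"
  unfolding negligible_outer_le
proof (intro allI impI)
  fix \<epsilon> :: real
  assume \<epsilon>: "\<epsilon> > 0"
  \<comment> \<open>The 14 stems from at most \<open>7 * N\<close> intervals of length
    \<open>2 * \<delta> / N\<close>. The bound 1 on \<open>\<delta>\<close> confines the numerators
    to \<open>{-1..4 * N + 1}\<close>.\<close>
  obtain k where k: "(c + 1) / min 1 (\<epsilon> / 14) < 2 ^ k"
    using real_arch_pow[of 2] by auto
  obtain n where n: "k \<le> digit_pos (Suc n) - digit_pos n"
    using digit_pos_gap_unbounded by blast
  define \<delta> where "\<delta> = c / 2 ^ (digit_pos (Suc n) - digit_pos n)"
  define N where "N = (2::int) ^ digit_pos n"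
  have N: "N \<ge> 1"
    by (simp add: N_def)
  have "(2::real) ^ k \<le> 2 ^ (digit_pos (Suc n) - digit_pos n)"
    using n by (intro power_increasing) auto
  moreover have min: "0 < min 1 (\<epsilon> / 14)"
    using \<epsilon> by simp
  ultimately have "2 ^ k * min 1 (\<epsilon> / 14) \<le> 2 ^ (digit_pos (Suc n) - digit_pos n) * min 1 (\<epsilon> / 14)"
    by (intro mult_right_mono) auto
  moreover have "c + 1 < 2 ^ k * min 1 (\<epsilon> / 14)"
    using k min pos_divide_less_eq by blast
  ultimately have "c \<le> min 1 (\<epsilon> / 14) * 2 ^ (digit_pos (Suc n) - digit_pos n)"
    by (simp add: mult.commute)
  then have \<delta>: "\<delta> \<le> min 1 (\<epsilon> / 14)"
    unfolding \<delta>_def by (subst pos_divide_le_eq) auto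
  have \<delta>0: "\<delta> \<ge> 0"
    using c by (simp add: \<delta>_def)
  define T where "T = (\<Union>m\<in>{-1..4 * N + 1}. cball (real_of_int m / N) (\<delta> / N))"
  have "lacunary c \<inter> {0..4} \<subseteq> T"
  proof
    fix x assume x: "x \<in> lacunary c \<inter> {0..4}"
    obtain i where i: "i \<in> \<int>" "infdist (2 ^ digit_pos n * x) \<int> = dist (2 ^ digit_pos n * x) i"
      using infdist_attains_inf[OF closed_Ints] Ints_0 by (metis empty_iff)
    then obtain m where m: "i = of_int m"
      by (auto elim: Ints_cases)
    have d: "\<bar>N * x - m\<bar> \<le> \<delta>"
      using x i m lacunaryD[of x c n] by (simp add: dist_real_def \<delta>_def N_def)
    have "0 \<le> N * x" "N * x \<le> N * 4"
      using x N by (auto intro!: mult_left_mono)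
    then have "-1 \<le> real_of_int m" "real_of_int m \<le> 4 * N + 1"
      using d \<delta> by linarith+
    then have "m \<in> {-1..4 * N + 1}"
      by simp
    moreover have "x \<in> cball (real_of_int m / N) (\<delta> / N)"
    proof -
      have "\<bar>m / N - x\<bar> = \<bar>N * x - m\<bar> / N"
        using N by (simp add: abs_divide[symmetric] field_simps abs_minus_commute)
      then show ?thesis
        using d N by (simp add: dist_real_def divide_right_mono)
    qed
    ultimately show "x \<in> T"
      unfolding T_def by blast
  qed
  moreover have "T \<in> lmeasurable"
    unfolding T_def by (intro fmeasurable.finite_UN) auto
  moreover have "measure lebesgue T \<le> \<epsilon>"
  proof -
    have "measure lebesgue T \<le> (\<Sum>m\<in>{-1..4 * N + 1}. measure lebesgue (cball (real_of_int m / N) (\<delta> / N)))"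
      unfolding T_def by (intro measure_UNION_le) auto
    also have "\<dots> = (\<Sum>m\<in>{-1..4 * N + 1}. 2 * (\<delta> / N))"
      using \<delta>0 N by (intro sum.cong) (simp_all add: cball_eq_atLeastAtMost)
    also have "\<dots> = (4 * N + 3) * (2 * (\<delta> / N))"
      using N by simp
    also have "\<dots> \<le> 7 * N * (2 * (\<delta> / N))"
      using N \<delta>0 by (intro mult_right_mono) auto
    also have "\<dots> = 14 * \<delta>"
      using N by simp
    finally show ?thesis
      using \<delta> by simp
  qed
  ultimately show "\<exists>T. lacunary c \<inter> {0..4} \<subseteq> T \<and> T \<in> lmeasurable \<and> measure lebesgue T \<le> \<epsilon>"
    by blast
qed

section \<open>The compact set and the null sets that it sweeps out\<close>

text \<open>A strip over a null set is null, and differentiable maps between spaces of equal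
  dimension preserve this. Closedness makes \<open>S\<close> Borel, hence null for
  \<open>lborel\<close> too.\<close>

lemma negligible_image_strip:
  fixes f :: "real \<times> real \<Rightarrow> complex"
  assumes "closed S" "negligible S" and f: "f differentiable_on (S \<times> UNIV)"
  shows "negligible (f ` (S \<times> UNIV))"
proof -
  have "S \<in> null_sets lborel"
    using assms by (simp add: negligible_iff_null_sets null_sets_completion_iff)
  then have "S \<times> (UNIV :: real set) \<in> null_sets (lborel \<Otimes>\<^sub>M lborel)"
    by (intro lborel.times_in_null_sets1) auto
  then have "negligible (S \<times> (UNIV :: real set))"
    unfolding negligible_iff_null_sets lborel_prod by (rule null_sets_completionI)
  then show ?thesis
    by (intro negligible_differentiable_image_negligible[OF _ _ f]) auto
qed

definition Kakeya_coordinates :: "real set" where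
  "Kakeya_coordinates = {x. 0 \<le> x \<and> x\<^sup>2 \<in> lacunary 2 \<inter> {1..2}}"

definition Kakeya_set :: "complex set" where
  "Kakeya_set = {z. Re z \<in> Kakeya_coordinates \<and> Im z \<in> Kakeya_coordinates}"

lemma Kakeya_coordinates_bounds:
  assumes "x \<in> Kakeya_coordinates"
  shows "1 \<le> x" "x \<le> 2"
proof -
  have x: "0 \<le> x" "1 \<le> x\<^sup>2" "x\<^sup>2 \<le> 2"
    using assms by (auto simp: Kakeya_coordinates_def)
  show "1 \<le> x"
    by (rule power2_le_imp_le) (use x in auto)
  show "x \<le> 2"
    by (rule power2_le_imp_le) (use x in auto)
qed

lemma compact_Kakeya_set: "compact Kakeya_set"
proof (rule compact_eq_bounded_closed[THEN iffD2], rule conjI)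
  have "norm z \<le> 4" if "z \<in> Kakeya_set" for z
    using that cmod_le[of z] Kakeya_coordinates_bounds[of "Re z"] Kakeya_coordinates_bounds[of "Im z"]
    by (simp add: Kakeya_set_def)
  then show "bounded Kakeya_set"
    by (auto simp: bounded_iff)
  have "closed ((\<lambda>x. x\<^sup>2) -` (lacunary 2 \<inter> {1..2}) \<inter> {0::real..})"
    by (intro closed_vimage_Int closed_Int closed_lacunary continuous_intros)
  moreover have "Kakeya_coordinates = (\<lambda>x. x\<^sup>2) -` (lacunary 2 \<inter> {1..2}) \<inter> {0..}"
    by (auto simp: Kakeya_coordinates_def)
  ultimately have "closed Kakeya_coordinates"
    by simp
  then have "closed (Re -` Kakeya_coordinates \<inter> Im -` Kakeya_coordinates)"
    by (intro closed_Int closed_vimage continuous_intros)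
  moreover have "Kakeya_set = Re -` Kakeya_coordinates \<inter> Im -` Kakeya_coordinates"
    by (auto simp: Kakeya_set_def)
  ultimately show "closed Kakeya_set"
    by simp
qed

text \<open>Polar coordinates, with the squared radius as first parameter, show the swept set as the
  image of a strip.\<close>

lemma negligible_rotated_Kakeya_set: "negligible (\<Union>\<theta>. (\<lambda>x. cis \<theta> * x) ` Kakeya_set)"
proof (rule negligible_subset)
  \<comment> \<open>Squared moduli are sums of two numbers in \<open>{1..2}\<close>; the lower bound
    2 keeps \<open>sqrt\<close> differentiable.\<close>
  let ?S = "lacunary 4 \<inter> {0..4} \<inter> {2..}"
  let ?f = "\<lambda>p. complex_of_real (sqrt (fst p)) * cis (snd p)"
  show "negligible (?f ` (?S \<times> UNIV))"
  proof (rule negligible_image_strip)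
    show "closed ?S"
      by (intro closed_Int closed_lacunary) auto
    show "negligible ?S"
      by (intro negligible_Int negligible_lacunary disjI1) auto
    have "\<exists>D. (?f has_derivative D) (at p)" if "0 < fst p" for p
      unfolding cis.ctr Complex_eq using that by (intro exI) (auto intro!: derivative_eq_intros)
    then show "?f differentiable_on (?S \<times> UNIV)"
      by (intro differentiable_at_imp_differentiable_on) (auto simp: differentiable_def)
  qed
  show "(\<Union>\<theta>. (\<lambda>x. cis \<theta> * x) ` Kakeya_set) \<subseteq> ?f ` (?S \<times> UNIV)"
  proof clarify
    fix \<theta> x assume x: "x \<in> Kakeya_set"
    define z where "z = cis \<theta> * x"
    have "(norm z)\<^sup>2 = (Re x)\<^sup>2 + (Im x)\<^sup>2"
      by (simp add: z_def norm_mult cmod_power2)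
    then have "(norm z)\<^sup>2 \<in> ?S"
      using x lacunary_add[of "(Re x)\<^sup>2" 2 "(Im x)\<^sup>2" 2]
      by (auto simp: Kakeya_set_def Kakeya_coordinates_def)
    moreover have "z = ?f ((norm z)\<^sup>2, Arg z)"
      using rcis_cmod_Arg[of z] by (simp add: rcis_def)
    ultimately show "cis \<theta> * x \<in> ?f ` (?S \<times> UNIV)"
      unfolding z_def[symmetric] by (intro image_eqI[of _ _ "((norm z)\<^sup>2, Arg z)"]) auto
  qed
qed

text \<open>Motion along one axis leaves the other coordinate fixed, which is up to a constant the
  root of a number in a null set. The \<open>c\<close> allows for a preceding translation,
  \<open>u\<close> for the rotation.\<close>

lemma negligible_translated_Kakeya_set:
  shows "negligible (\<Union>r. (\<lambda>x. u * (x + of_real r)) ` Kakeya_set)" (is ?real)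
    and "negligible (\<Union>r. (\<lambda>x. u * (x + c + \<i> * of_real r)) ` Kakeya_set)" (is ?imag)
proof -
  let ?S = "lacunary 2 \<inter> {0..4} \<inter> {1..2}"
  have S: "closed ?S" "negligible ?S"
    by (intro closed_Int closed_lacunary negligible_Int negligible_lacunary disjI1; simp)+
  have sq: "x\<^sup>2 \<in> ?S" "sqrt (x\<^sup>2) = x" if "x \<in> Kakeya_coordinates" for x
    using that by (auto simp: Kakeya_coordinates_def)
  show ?real
  proof (rule negligible_subset)
    let ?f = "\<lambda>p. u * (complex_of_real (snd p) + \<i> * of_real (sqrt (fst p)))"
    have "\<exists>D. (?f has_derivative D) (at p)" if "0 < fst p" for p
      using that by (intro exI) (auto intro!: derivative_eq_intros)
    then have "?f differentiable_on (?S \<times> UNIV)"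
      by (intro differentiable_at_imp_differentiable_on) (auto simp: differentiable_def)
    then show "negligible (?f ` (?S \<times> UNIV))"
      by (rule negligible_image_strip[OF S])
    show "(\<Union>r. (\<lambda>x. u * (x + of_real r)) ` Kakeya_set) \<subseteq> ?f ` (?S \<times> UNIV)"
    proof clarify
      fix r x assume "x \<in> Kakeya_set"
      then have "Im x \<in> Kakeya_coordinates"
        by (simp add: Kakeya_set_def)
      note sq = sq[OF this]
      have "u * (x + of_real r) = ?f ((Im x)\<^sup>2, Re x + r)"
        by (simp only: fst_conv snd_conv sq) (simp add: complex_eq_iff)
      then show "u * (x + of_real r) \<in> ?f ` (?S \<times> UNIV)"
        using sq by (intro image_eqI[of _ _ "((Im x)\<^sup>2, Re x + r)"]) auto
    qed
  qed
  show ?imag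
  proof (rule negligible_subset)
    \<comment> \<open>Only \<open>Re c\<close> occurs, as \<open>Im c\<close> is absorbed by the
      parameter that runs over the whole line.\<close>
    let ?f = "\<lambda>p. u * (complex_of_real (sqrt (fst p)) + of_real (Re c) + \<i> * of_real (snd p))"
    have "\<exists>D. (?f has_derivative D) (at p)" if "0 < fst p" for p
      using that by (intro exI) (auto intro!: derivative_eq_intros)
    then have "?f differentiable_on (?S \<times> UNIV)"
      by (intro differentiable_at_imp_differentiable_on) (auto simp: differentiable_def)
    then show "negligible (?f ` (?S \<times> UNIV))"
      by (rule negligible_image_strip[OF S])
    show "(\<Union>r. (\<lambda>x. u * (x + c + \<i> * of_real r)) ` Kakeya_set) \<subseteq> ?f ` (?S \<times> UNIV)"
    proof clarify
      fix r x assume "x \<in> Kakeya_set"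
      then have "Re x \<in> Kakeya_coordinates"
        by (simp add: Kakeya_set_def)
      note sq = sq[OF this]
      have "u * (x + c + \<i> * of_real r) = ?f ((Re x)\<^sup>2, Im x + Im c + r)"
        by (simp only: fst_conv snd_conv sq) (simp add: complex_eq_iff)
      then show "u * (x + c + \<i> * of_real r) \<in> ?f ` (?S \<times> UNIV)"
        using sq by (intro image_eqI[of _ _ "((Re x)\<^sup>2, Im x + Im c + r)"]) auto
    qed
  qed
qed

lemma strong_Kakeya_Kakeya_set: "strong_Kakeya Kakeya_set"
  unfolding strong_Kakeya_def
proof (intro allI impI, elim conjE)
  fix \<alpha> :: "complex \<Rightarrow> complex" and \<epsilon> :: real
  assume "rigid_motion \<alpha>" and \<epsilon>: "0 < \<epsilon>"
  then obtain u c where u: "norm u = 1" and \<alpha>: "\<alpha> = (\<lambda>x. u * x + c)"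
    by (auto simp: rigid_motion_def)
  define \<theta> where "\<theta> = Arg u"
  have cis: "cis \<theta> = u"
    using u rcis_cmod_Arg[of u] by (simp add: \<theta>_def rcis_def)
  \<comment> \<open>The translation part is resolved along the axes rotated by
    \<open>u\<close>.\<close>
  define p q where "p = Re (c / u)" and "q = Im (c / u)"
  have "c / u = of_real p + \<i> * of_real q"
    unfolding p_def q_def by (rule complex_eq)
  then have c: "u * (of_real p + \<i> * of_real q) = c"
    using u by (metis nonzero_mult_div_cancel_left norm_zero times_divide_eq_right zero_neq_one)
  \<comment> \<open>A clock for three successive stages: \<open>phase i\<close> rises from 0 to 1
    between the times \<open>i / 3\<close> and \<open>(i + 1) / 3\<close>, and is constant before
    and after.\<close>
  define phase :: "nat \<Rightarrow> real \<Rightarrow> real" where "phase i t = max 0 (min 1 (3 * t - real i))" for i t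
  define M where "M t x = cis (phase 0 t * \<theta>) * x
      + u * (of_real (phase 1 t * p) + \<i> * of_real (phase 2 t * q))" for t x
  have "continuous_movement M"
    unfolding continuous_movement_def
  proof (intro conjI ballI)
    show "rigid_motion (M t)" for t
      unfolding rigid_motion_def M_def
      by (rule exI[of _ "cis (phase 0 t * \<theta>)"]) auto
    show "continuous_on ({0..1} \<times> UNIV) (\<lambda>(t, x). M t x)"
      unfolding M_def phase_def cis_conv_exp case_prod_beta by (intro continuous_intros)
    show "M 0 = id"
      by (auto simp: M_def phase_def)
  qed
  moreover have "M 1 = \<alpha>"
    using c by (auto simp: M_def phase_def \<alpha> cis)
  \<comment> \<open>Subsets of null sets are measurable for \<open>lebesgue\<close>, so this yields
    both the measurability and the bound by \<open>\<epsilon>\<close>.\<close>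
  moreover have "swept_set M Kakeya_set \<in> null_sets lebesgue"
  proof -
    let ?Z1 = "\<Union>\<theta>. (\<lambda>x. cis \<theta> * x) ` Kakeya_set"
    let ?Z2 = "\<Union>r. (\<lambda>x. u * (x + complex_of_real r)) ` Kakeya_set"
    let ?Z3 = "\<Union>r. (\<lambda>x. u * (x + of_real p + \<i> * of_real r)) ` Kakeya_set"
    have *: "M t x \<in> ?Z1 \<union> ?Z2 \<union> ?Z3" if x: "x \<in> Kakeya_set" for t x
    proof -
      consider "t \<le> 1 / 3" | "1 / 3 \<le> t" "t \<le> 2 / 3" | "2 / 3 \<le> t"
        by linarith
      then show ?thesis
      proof cases
        case 1
        then have "M t x = cis (phase 0 t * \<theta>) * x"
          by (simp add: M_def phase_def)
        then show ?thesis
          using x by blast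
      next
        case 2
        then have "M t x = u * (x + of_real (phase 1 t * p))"
          by (simp add: M_def phase_def cis algebra_simps)
        then show ?thesis
          using x by blast
      next
        case 3
        then have "M t x = u * (x + of_real p + \<i> * of_real (phase 2 t * q))"
          by (simp add: M_def phase_def cis algebra_simps)
        then show ?thesis
          using x by blast
      qed
    qed
    have "swept_set M Kakeya_set \<subseteq> ?Z1 \<union> ?Z2 \<union> ?Z3"
    proof
      fix y assume "y \<in> swept_set M Kakeya_set"
      then obtain t x where "y = M t x" "x \<in> Kakeya_set"
        unfolding swept_set_def by blast
      then show "y \<in> ?Z1 \<union> ?Z2 \<union> ?Z3"
        using * by simp
    qed
    moreover have "negligible (?Z1 \<union> ?Z2 \<union> ?Z3)"
      by (intro negligible_Un negligible_rotated_Kakeya_set negligible_translated_Kakeya_set)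
    ultimately show ?thesis
      using negligible_subset negligible_iff_null_sets by blast
  qed
  ultimately show "\<exists>M. continuous_movement M \<and> M 1 = \<alpha> \<and>
      swept_set M Kakeya_set \<in> sets lebesgue \<and> emeasure lebesgue (swept_set M Kakeya_set) < ennreal \<epsilon>"
    using \<epsilon> by (intro exI[of _ M]) (auto simp: null_sets_def)
qed

section \<open>Lower bound for the Hausdorff dimension\<close>

text \<open>A cover of \<open>A\<close> by sets \<open>U i\<close> pulls back along \<open>G\<close>
  to a cover of \<open>B\<close>, whose pieces lie in balls of volume at most a constant times
  \<open>diam_powr s (U i)\<close>. So the volume of \<open>B\<close> bounds the sums from
  below.\<close>

lemma hausdorff_measure_nonzero_if_Hoelder_inverse:
  fixes G :: "'a::euclidean_space \<Rightarrow> 'b::metric_space"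
  assumes "0 < K" "0 \<le> s" "0 < b"
    and G: "\<And>z. z \<in> B \<Longrightarrow> G z \<in> A"
    and B: "ennreal b \<le> emeasure lborel B"
    and H: "\<And>z w. \<lbrakk>z \<in> B; w \<in> B\<rbrakk> \<Longrightarrow> dist z w ^ DIM('a) \<le> K * dist (G z) (G w) powr s"
  shows "hausdorff_measure s A \<noteq> 0"
proof
  assume "hausdorff_measure s A = 0"
  then have "hausdorff_premeasure s 1 A = 0"
    unfolding hausdorff_measure_def by (metis SUP_upper greaterThan_iff le_zero_eq zero_less_one)
  define C where "C = unit_ball_vol (real DIM('a)) * K"
  have C: "C > 0"
    using \<open>0 < K\<close> by (simp add: C_def)
  have "(INF U\<in>countable_covers 1 A. \<Sum>i. diam_powr s (U i)) < ennreal (b / C)"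
    using \<open>hausdorff_premeasure s 1 A = 0\<close> C \<open>0 < b\<close> by (simp add: hausdorff_premeasure_def)
  then obtain U where U: "U \<in> countable_covers 1 A" "(\<Sum>i. diam_powr s (U i)) < ennreal (b / C)"
    by (auto simp: INF_less_iff)
  define V where "V i = {z \<in> B. G z \<in> U i}" for i
  define r where "r i = root DIM('a) (K * diameter (U i) powr s)" for i
  have bd: "bounded (U i)" for i
    using U(1) by (simp add: countable_covers_def)
  have r0: "0 \<le> r i" for i
    using \<open>0 < K\<close> by (simp add: r_def)
  have rp: "r i ^ DIM('a) = K * diameter (U i) powr s" for i
    using \<open>0 < K\<close> by (simp add: r_def)
  \<comment> \<open>The pieces \<open>V i\<close> may fail to be measurable and are therefore
    enclosed in Borel sets.\<close>
  have "\<exists>W. W \<in> sets lborel \<and> V i \<subseteq> W \<and> emeasure lborel W \<le> ennreal C * diam_powr s (U i)" for i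
  proof (cases "V i = {}")
    case True
    then show ?thesis
      by (intro exI[of _ "{}"]) auto
  next
    case False
    then obtain w where w: "w \<in> B" "G w \<in> U i"
      by (auto simp: V_def)
    have "V i \<subseteq> cball w (r i)"
    proof
      fix z assume "z \<in> V i"
      then have z: "z \<in> B" "G z \<in> U i"
        by (auto simp: V_def)
      have "dist w z ^ DIM('a) \<le> K * dist (G w) (G z) powr s"
        using H z w by blast
      also have "\<dots> \<le> K * diameter (U i) powr s"
        using z w bd \<open>0 < K\<close> \<open>0 \<le> s\<close>
        by (intro mult_left_mono powr_mono2 diameter_bounded_bound) auto
      finally have "dist w z ^ DIM('a) \<le> r i ^ DIM('a)"
        by (simp add: rp)
      then show "z \<in> cball w (r i)"
        using power_mono_iff[of "dist w z" "r i" "DIM('a)"] r0 by simp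
    qed
    moreover have "emeasure lborel (cball w (r i)) = ennreal (C * diameter (U i) powr s)"
      using emeasure_cball[OF r0, of w i] by (simp add: rp C_def mult.assoc)
    \<comment> \<open>Only an inequality: if \<open>s = 0\<close> and \<open>U i\<close> has
      diameter 0, the left side vanishes by \<open>0 powr 0 = 0\<close>, but
      \<open>diam_powr\<close> is 1.\<close>
    moreover have "ennreal (C * diameter (U i) powr s) \<le> ennreal C * diam_powr s (U i)"
    proof -
      have "ennreal (diameter (U i) powr s) \<le> diam_powr s (U i)"
        using w by (auto simp: diam_powr_def)
      then show ?thesis
        using C by (simp add: ennreal_mult mult_left_mono)
    qed
    ultimately show ?thesis
      by (intro exI[of _ "cball w (r i)"]) auto
  qed
  then obtain W where W: "\<And>i. W i \<in> sets lborel" "\<And>i. V i \<subseteq> W i"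
    "\<And>i. emeasure lborel (W i) \<le> ennreal C * diam_powr s (U i)"
    by metis
  have "B \<subseteq> (\<Union>i. W i)"
    using G U(1) W(2) by (fastforce simp: countable_covers_def V_def)
  then have "ennreal b \<le> emeasure lborel (\<Union>i. W i)"
    using W(1) by (intro order_trans[OF B] emeasure_mono) auto
  also have "\<dots> \<le> (\<Sum>i. emeasure lborel (W i))"
    using W(1) by (intro emeasure_subadditive_countably) auto
  also have "\<dots> \<le> (\<Sum>i. ennreal C * diam_powr s (U i))"
    using W(3) by (intro suminf_le) auto
  also have "\<dots> = ennreal C * (\<Sum>i. diam_powr s (U i))"
    by simp
  also have "\<dots> < ennreal b"
  proof -
    obtain x where x: "0 \<le> x" "(\<Sum>i. diam_powr s (U i)) = ennreal x"
      using U(2) by (cases "\<Sum>i. diam_powr s (U i)") auto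
    then have "x < b / C"
      using U(2) by (simp add: ennreal_less_iff)
    then have "C * x < b"
      using C by (simp add: field_simps)
    then show ?thesis
      using x C by (simp add: ennreal_mult[symmetric] ennreal_less_iff)
  qed
  finally show False
    by simp
qed

lemma hausdorff_measure_Kakeya_set_nonzero:
  assumes s: "0 \<le> s" "s < 2"
  shows "hausdorff_measure s Kakeya_set \<noteq> 0"
proof -
  define h where "h x = sqrt (1 + insert_zeros x)" for x
  define B where "B = ball (Complex (1/2) (1/2)) (1/2)"
  have B: "0 \<le> Re z" "Re z < 1" "0 \<le> Im z" "Im z < 1" if "z \<in> B" for z
    using that abs_Re_le_cmod[of "Complex (1/2) (1/2) - z"] abs_Im_le_cmod[of "Complex (1/2) (1/2) - z"]
    by (auto simp: B_def dist_norm)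
  obtain K where K: "K > 0"
    "\<And>x y. \<lbrakk>0 \<le> x; x < 1; 0 \<le> y; y < 1\<rbrakk> \<Longrightarrow>
       (x - y)\<^sup>2 \<le> K * \<bar>insert_zeros x - insert_zeros y\<bar> powr s"
    using insert_zeros_Hoelder[OF s] by blast
  \<comment> \<open>The square roots cost only a factor 4: a difference of squares is the difference
    times the sum, and the sum is at most 4.\<close>
  have coord: "(x - y)\<^sup>2 \<le> K * (4 * d) powr s"
    if xy: "0 \<le> x" "x < 1" "0 \<le> y" "y < 1" and d: "\<bar>h x - h y\<bar> \<le> d" for x y d
  proof -
    have h: "0 \<le> h x" "h x \<le> 2" "(h x)\<^sup>2 = 1 + insert_zeros x" if "0 \<le> x" "x < 1" for x
      using insert_zeros_bounds[OF that] by (auto simp: h_def intro!: real_le_lsqrt)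
    have "insert_zeros x - insert_zeros y = (h x + h y) * (h x - h y)"
      using h[of x] h[of y] xy by (simp add: power2_eq_square algebra_simps)
    then have "\<bar>insert_zeros x - insert_zeros y\<bar> = (h x + h y) * \<bar>h x - h y\<bar>"
      using h(1)[of x] h(1)[of y] xy by (simp add: abs_mult)
    also have "\<dots> \<le> 4 * d"
      using h[of x] h[of y] xy d by (intro mult_mono) auto
    finally have "\<bar>insert_zeros x - insert_zeros y\<bar> powr s \<le> (4 * d) powr s"
      using s by (intro powr_mono2) auto
    then show ?thesis
      using K(2)[OF xy] \<open>K > 0\<close> by (meson mult_left_mono less_imp_le order_trans)
  qed
  show ?thesis
  proof (rule hausdorff_measure_nonzero_if_Hoelder_inverse)
    show "0 < 2 * K * 4 powr s"
      using K by simp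
    show "0 \<le> s"
      by fact
    show "0 < unit_ball_vol (real DIM(complex)) * (1/2) ^ DIM(complex)"
      by simp
    show "ennreal (unit_ball_vol (real DIM(complex)) * (1/2) ^ DIM(complex)) \<le> emeasure lborel B"
      unfolding B_def by (subst emeasure_ball) auto
    show "Complex (h (Re z)) (h (Im z)) \<in> Kakeya_set" if "z \<in> B" for z
      using insert_zeros_bounds[of "Re z"] insert_zeros_bounds[of "Im z"]
        insert_zeros_lacunary[of "Re z"] insert_zeros_lacunary[of "Im z"] B[OF that]
      by (auto simp: Kakeya_set_def Kakeya_coordinates_def h_def)
    show "dist z w ^ DIM(complex)
        \<le> 2 * K * 4 powr s * dist (Complex (h (Re z)) (h (Im z))) (Complex (h (Re w)) (h (Im w))) powr s"
      if zw: "z \<in> B" "w \<in> B" for z w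
    proof -
      let ?v = "Complex (h (Re z)) (h (Im z)) - Complex (h (Re w)) (h (Im w))"
      have "(dist z w)\<^sup>2 = (Re z - Re w)\<^sup>2 + (Im z - Im w)\<^sup>2"
        by (simp add: dist_norm cmod_power2)
      also have "\<dots> \<le> K * (4 * norm ?v) powr s + K * (4 * norm ?v) powr s"
      proof (intro add_mono coord)
        show "\<bar>h (Re z) - h (Re w)\<bar> \<le> norm ?v"
          using abs_Re_le_cmod[of ?v] by simp
        show "\<bar>h (Im z) - h (Im w)\<bar> \<le> norm ?v"
          using abs_Im_le_cmod[of ?v] by simp
      qed (fact B[OF zw(1)] B[OF zw(2)])+
      also have "\<dots> = 2 * K * 4 powr s * norm ?v powr s"
        by (simp add: powr_mult)
      finally show ?thesis
        by (simp add: dist_norm)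
    qed
  qed
qed

section \<open>Upper bound for the Hausdorff dimension, and conclusion\<close>

text \<open>A unit square is covered by \<open>(n + 1) ^ 2\<close> discs of diameter
  \<open>4 / n\<close>, and for \<open>s > 2\<close> the sum of the powers tends to 0 as
  \<open>n\<close> grows.\<close>

lemma hausdorff_measure_planar_eq_0:
  fixes A :: "complex set"
  assumes A: "\<And>z. z \<in> A \<Longrightarrow> Re z \<in> {a..a + 1} \<and> Im z \<in> {b..b + 1}" and s: "2 < s"
  shows "hausdorff_measure s A = 0"
proof -
  have small: "hausdorff_premeasure s \<delta> A \<le> 0 + ennreal e" if "0 < \<delta>" "0 < e" for \<delta> e
  proof -
    have "((\<lambda>n. (real n + 1)\<^sup>2 * (4 / real n) powr s) \<longlongrightarrow> 0) at_top"
      using s by real_asymp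
    then have "eventually (\<lambda>n. (real n + 1)\<^sup>2 * (4 / real n) powr s < e) at_top"
      using \<open>0 < e\<close> by (rule order_tendstoD)
    moreover have "eventually (\<lambda>n. 4 / real n < \<delta>) at_top"
      using \<open>0 < \<delta>\<close> by real_asymp
    ultimately have "eventually (\<lambda>n. 0 < n \<and> (real n + 1)\<^sup>2 * (4 / real n) powr s < e \<and> 4 / real n < \<delta>) at_top"
      using eventually_gt_at_top[of "0::nat"] by eventually_elim auto
    then obtain n :: nat where n: "0 < n" "(real n + 1)\<^sup>2 * (4 / real n) powr s < e" "4 / real n < \<delta>"
      by (metis (mono_tags, lifting) eventually_happens' sequentially_bot)
    \<comment> \<open>One more than \<open>n\<close> per side, because a point on the far edge of
      the square has index \<open>n\<close>.\<close>
    define m where "m = Suc n"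
    \<comment> \<open>\<open>mod\<close> and \<open>div\<close> enumerate the grid. The radius is
      \<open>2 / n\<close> because each coordinate is within \<open>1 / n\<close> of the grid; the
      empty sets contribute 0.\<close>
    define U where "U i = (if i < m * m
      then cball (Complex (a + real (i mod m) / n) (b + real (i div m) / n)) (2 / n) else {})" for i
    have "U \<in> countable_covers \<delta> A"
      unfolding countable_covers_def
    proof (intro CollectI conjI allI subsetI)
      fix z assume z: "z \<in> A"
      define k l where "k = nat \<lfloor>n * (Re z - a)\<rfloor>" and "l = nat \<lfloor>n * (Im z - b)\<rfloor>"
      have index: "real (nat \<lfloor>n * x\<rfloor>) \<le> n * x" "n * x < real (nat \<lfloor>n * x\<rfloor>) + 1" "nat \<lfloor>n * x\<rfloor> < m"
        if "0 \<le> x" "x \<le> 1" for x :: real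
      proof -
        have "0 \<le> n * x" "n * x \<le> n"
          using that by (auto intro: mult_left_le)
        then show "real (nat \<lfloor>n * x\<rfloor>) \<le> n * x" "n * x < real (nat \<lfloor>n * x\<rfloor>) + 1" "nat \<lfloor>n * x\<rfloor> < m"
          unfolding m_def by linarith+
      qed
      have near: "\<bar>real (nat \<lfloor>n * x\<rfloor>) / n - x\<bar> \<le> 1 / n" if "0 \<le> x" "x \<le> 1" for x :: real
      proof -
        have "\<bar>real (nat \<lfloor>n * x\<rfloor>) / n - x\<bar> = \<bar>real (nat \<lfloor>n * x\<rfloor>) - n * x\<bar> / n"
          using n by (subst abs_div_pos) (simp_all add: diff_divide_distrib)
        also have "\<dots> \<le> 1 / n"
        proof (rule divide_right_mono)
          show "\<bar>real (nat \<lfloor>n * x\<rfloor>) - n * x\<bar> \<le> 1"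
            using index(1,2)[OF that] unfolding abs_le_iff by linarith
        qed simp
        finally show ?thesis .
      qed
      have kl: "k < m" "l < m"
        unfolding k_def l_def using A[OF z] by (auto intro!: index)
      define i where "i = k + m * l"
      have "m * l + m \<le> m * m"
        using kl by (metis Suc_leI mult_Suc_right add.commute mult_le_mono2)
      then have i: "i < m * m" "i mod m = k" "i div m = l"
        using kl by (auto simp: i_def)
      have "norm (Complex (a + real k / n) (b + real l / n) - z)
          \<le> \<bar>a + real k / n - Re z\<bar> + \<bar>b + real l / n - Im z\<bar>"
        using cmod_le[of "Complex (a + real k / n) (b + real l / n) - z"] by simp
      also have "\<dots> = \<bar>real k / n - (Re z - a)\<bar> + \<bar>real l / n - (Im z - b)\<bar>"
        by (simp add: algebra_simps)
      also have "\<dots> \<le> 1 / n + 1 / n"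
        unfolding k_def l_def using A[OF z] by (intro add_mono near) auto
      finally have "z \<in> U i"
        by (simp add: U_def i dist_norm)
      then show "z \<in> (\<Union>i. U i)"
        by blast
    next
      show "bounded (U i)" for i
        by (simp add: U_def)
      show "diameter (U i) \<le> \<delta>" for i
        using n \<open>0 < \<delta>\<close> by (simp add: U_def)
    qed
    then have "hausdorff_premeasure s \<delta> A \<le> (\<Sum>i. diam_powr s (U i))"
      unfolding hausdorff_premeasure_def by (rule INF_lower)
    also have "\<dots> = (\<Sum>i<m * m. diam_powr s (U i))"
      by (rule suminf_finite) (auto simp: U_def diam_powr_def)
    also have "\<dots> = (\<Sum>i<m * m. ennreal ((4 / n) powr s))"
      using s by (intro sum.cong) (auto simp: U_def diam_powr_def)
    also have "\<dots> = ennreal (real (m * m) * (4 / n) powr s)"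
      by (simp add: ennreal_mult ennreal_of_nat_eq_real_of_nat)
    also have "\<dots> \<le> ennreal e"
    proof (rule ennreal_leI)
      have eq: "real (m * m) = (real n + 1)\<^sup>2"
        by (simp add: m_def power2_eq_square algebra_simps)
      show "real (m * m) * (4 / n) powr s \<le> e"
        unfolding eq using n(2) by (rule less_imp_le)
    qed
    finally show ?thesis
      by simp
  qed
  have "hausdorff_premeasure s \<delta> A \<le> 0" if "0 < \<delta>" for \<delta>
    by (rule ennreal_le_epsilon) (rule small[OF that])
  then have "hausdorff_measure s A \<le> 0"
    unfolding hausdorff_measure_def by (intro SUP_least) blast
  then show ?thesis
    by simp
qed

text \<open>Among the exponents of measure zero are all those above 2, as the set lies in the unit
  square with corner \<open>(1, 1)\<close>, and none in \<open>[0, 2)\<close>.\<close>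

lemma hausdorff_dim_Kakeya_set: "hausdorff_dim Kakeya_set = 2"
proof (rule antisym)
  show "hausdorff_dim Kakeya_set \<le> 2"
  proof (rule ennreal_le_epsilon)
    fix e :: real assume "0 < e"
    have "hausdorff_measure (2 + e) Kakeya_set = 0"
      using \<open>0 < e\<close> Kakeya_coordinates_bounds
      by (intro hausdorff_measure_planar_eq_0[of _ 1 1]) (auto simp: Kakeya_set_def)
    then have "hausdorff_dim Kakeya_set \<le> ennreal (2 + e)"
      unfolding hausdorff_dim_def using \<open>0 < e\<close> by (intro Inf_lower CollectI exI[of _ "2 + e"]) simp
    then show "hausdorff_dim Kakeya_set \<le> 2 + ennreal e"
      using \<open>0 < e\<close> by simp
  qed
  show "2 \<le> hausdorff_dim Kakeya_set"
    unfolding hausdorff_dim_def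
  proof (rule Inf_greatest, clarify)
    fix s :: real assume "0 \<le> s" "hausdorff_measure s Kakeya_set = 0"
    then have "2 \<le> s"
      using hausdorff_measure_Kakeya_set_nonzero[of s] by linarith
    then have "ennreal 2 \<le> ennreal s"
      by (rule ennreal_leI)
    then show "2 \<le> ennreal s"
      by simp
  qed
qed

theorem mainTheorem4:
  shows "\<exists>A :: complex set. compact A \<and> strong_Kakeya A \<and> hausdorff_dim A = 2"
  using compact_Kakeya_set strong_Kakeya_Kakeya_set hausdorff_dim_Kakeya_set by blast

end
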